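(* Let the kernel pair $(M(x),K(x))$ belong to the Luchko set $\mathcal{L}_1(\mathbb{R}_+)$. Let $g(x)$ be an increasing and positive monotone function on $[a,b)$ with $-\infty<a<b<+\infty$, having a nonzero continuous first-order derivative $g^{(1)}(x)\ne0$ for all $x\in(a,b)$. Then the left-sided and right-sided parametric general fractional derivatives of Caputo type satisfy the equalities $$(D^{(K),*}_{a+,g}f)(x)=Q_g\,(D^{(K),*}_{g(a)+}\,Q_g^{-1}f)(x),$$ if $f\in C^1_{-1,g}(a,b]$, i.e. $f(g^{-1}(x))\in C^1_{-1}(a,b]$, and $$(D^{(K),*}_{b-,g}f)(x)=Q_g\,(D^{(K),*}_{g(b)-}\,Q_g^{-1}f)(x),$$ if $f\in C^1_{-1,g}[a,b)$, i.e. $f(g^{-1}(x))\in C^1_{-1}[a,b)$.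
   Context: Substitution operators: $(Q_gf)(x)=f(g(x))$ and $(Q_g^{-1}f)(x)=f(g^{-1}(x))$, where $g^{-1}$ is the inverse function of $g$. $f\in C^1_{-1,g}(a,b]$ means that the first-order derivative of $f$ can be represented as $f^{(1)}(x)=(g(x)-g(a))^p\,v_p(x)$ with $v_p\in C[a,b]$ and $p>-1$. $f\in C^1_{-1,g}[a,b)$ means that $f^{(1)}(x)=(g(b)-g(x))^q\,v_q(x)$ with $v_q\in C[a,b]$ and $q>-1$. $C^1_{-1}(a,b]$ and $C^1_{-1}[a,b)$ are these classes for $g(x)=x$. The Luchko set $\mathcal{L}_1(\mathbb{R}_+)$ consists of the pairs $(M(x),K(x))$, $x\in\mathbb{R}_+=(0,\infty)$, such that $M,K\in C_{-1}(0,b-a]$ and the Sonin condition holds: $$\int_0^x M(x-z)K(z)\,dz=\begin{cases}1,& x\in(0,b-a],\\ 0,& x\notin(0,b-a].\end{cases}$$ Here $F\in C_{-1}(0,b-a]$ means $F(x)=x^pG(x)$ for some $G\in C[0,b-a]$ and $p>-1$. Parametric derivatives of Caputo type, for $a<x\le b$ (left-sided) and $a\le x<b$ (right-sided): $$(D^{(K),*}_{a+,g}f)(x)=\int_a^x K(g(x)-g(u))f^{(1)}(u)\,du,\qquad (D^{(K),*}_{b-,g}f)(x)=-\int_x^b K(g(u)-g(x))f^{(1)}(u)\,du.$$ Non-parametric ones on a finite interval $(c,d)$ (the case $g(x)=x$): $$(D^{(K),*}_{c+}\varphi)(x)=\int_c^x K(x-u)\varphi^{(1)}(u)\,du,\qquad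 (D^{(K),*}_{d-}\varphi)(x)=-\int_x^d K(u-x)\varphi^{(1)}(u)\,du.$$ *)

theory Defs
  imports "HOL-Analysis.Analysis"
begin

definition subst_op :: "(real \<Rightarrow> real) \<Rightarrow> (real \<Rightarrow> real) \<Rightarrow> real \<Rightarrow> real"
  where "subst_op g f = (\<lambda>x. f (g x))"

text \<open>The inverse function of \<open>g\<close> is taken on the interval \<open>[a, b]\<close>.\<close>

definition inv_subst_op :: "real \<Rightarrow> real \<Rightarrow> (real \<Rightarrow> real) \<Rightarrow> (real \<Rightarrow> real) \<Rightarrow> real \<Rightarrow> real"
  where "inv_subst_op a b g f = (\<lambda>w. f (inv_into {a..b} g w))"

definition C_minus1 :: "real \<Rightarrow> (real \<Rightarrow> real) set"
  where "C_minus1 T =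
    {F. \<exists>p G. p > -1 \<and> continuous_on {0..T} G \<and> (\<forall>x\<in>{0<..T}. F x = x powr p * G x)}"

text \<open>
  The Sonin integral is required to converge, also for \<open>x > T\<close>: a divergent
  Lebesgue integral has the value 0 in the library and would otherwise count as
  satisfying the second case.
\<close>

definition luchko_L1 :: "real \<Rightarrow> ((real \<Rightarrow> real) \<times> (real \<Rightarrow> real)) set"
  where "luchko_L1 T =
    {(M, K). M \<in> C_minus1 T \<and> K \<in> C_minus1 T \<and>
      (\<forall>x>0. set_integrable lebesgue {0<..<x} (\<lambda>z. M (x - z) * K z) \<and>
        (LINT z:{0<..<x}|lebesgue. M (x - z) * K z) = (if x \<in> {0<..T} then 1 else 0))}"

text \<open>At the closed end of the interval the derivative is one-sided.\<close>

definition C1_minus1_left :: "(real \<Rightarrow> real) \<Rightarrow> real \<Rightarrow> real \<Rightarrow> (real \<Rightarrow> real) set"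
  where "C1_minus1_left g a b =
    {f. \<exists>p v. p > -1 \<and> continuous_on {a..b} v \<and>
      (\<forall>x\<in>{a<..b}. (f has_real_derivative (g x - g a) powr p * v x) (at x within {a<..b}))}"

definition C1_minus1_right :: "(real \<Rightarrow> real) \<Rightarrow> real \<Rightarrow> real \<Rightarrow> (real \<Rightarrow> real) set"
  where "C1_minus1_right g a b =
    {f. \<exists>q v. q > -1 \<and> continuous_on {a..b} v \<and>
      (\<forall>x\<in>{a..<b}. (f has_real_derivative (g b - g x) powr q * v x) (at x within {a..<b}))}"

text \<open>
  The endpoints are left out of the domains of integration because \<open>K\<close> is only
  meaningful on positive arguments. The non-parametric operators on
  \<open>(c, d)\<close> are the instances with \<open>g = (\<lambda>x. x)\<close>.
\<close>

definition gfd_caputo_left ::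
  "(real \<Rightarrow> real) \<Rightarrow> (real \<Rightarrow> real) \<Rightarrow> real \<Rightarrow> (real \<Rightarrow> real) \<Rightarrow> real \<Rightarrow> real"
  where "gfd_caputo_left K g a f x = (LINT u:{a<..<x}|lebesgue. K (g x - g u) * deriv f u)"

definition gfd_caputo_right ::
  "(real \<Rightarrow> real) \<Rightarrow> (real \<Rightarrow> real) \<Rightarrow> real \<Rightarrow> (real \<Rightarrow> real) \<Rightarrow> real \<Rightarrow> real"
  where "gfd_caputo_right K g b f x = - (LINT u:{x<..<b}|lebesgue. K (g u - g x) * deriv f u)"

text \<open>Convergence of the integrals in the two preceding definitions:\<close>

definition gfd_caputo_left_defined ::
  "(real \<Rightarrow> real) \<Rightarrow> (real \<Rightarrow> real) \<Rightarrow> real \<Rightarrow> (real \<Rightarrow> real) \<Rightarrow> real \<Rightarrow> bool"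
  where "gfd_caputo_left_defined K g a f x \<longleftrightarrow>
    set_integrable lebesgue {a<..<x} (\<lambda>u. K (g x - g u) * deriv f u)"

definition gfd_caputo_right_defined ::
  "(real \<Rightarrow> real) \<Rightarrow> (real \<Rightarrow> real) \<Rightarrow> real \<Rightarrow> (real \<Rightarrow> real) \<Rightarrow> real \<Rightarrow> bool"
  where "gfd_caputo_right_defined K g b f x \<longleftrightarrow>
    set_integrable lebesgue {x<..<b} (\<lambda>u. K (g u - g x) * deriv f u)"

end

theory Submission
  imports Defs
begin

text \<open>Both equalities are the substitution \<open>w = g u\<close>. Since \<open>g\<close> is
  continuous on \<open>{a..b}\<close> with positive derivative inside, it is a strictly increasing
  bijection from \<open>{c<..<d}\<close> onto \<open>{g c<..<g d}\<close> for all a \<le> c < d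
  \<le> b. Write \<open>h\<close> for f composed with the inverse of g. The chain rule gives
  \<open>deriv f u = deriv h (g u) * deriv g u\<close>, so the Jacobian needed by the substitution
  is exactly the factor relating the two derivatives, while the kernel depends on \<open>u\<close>
  only through \<open>g u\<close>. \<open>deriv_inv_subst_op\<close> supplies the chain rule, and
  \<open>set_integral_change_of_variables_incr\<close> transfers both convergence and value of the
  integral.\<close>

lemma set_integral_change_of_variables_incr:
  fixes g g' F :: "real \<Rightarrow> real"
  assumes "S \<in> sets lebesgue"
    and "\<And>x. x \<in> S \<Longrightarrow> (g has_real_derivative g' x) (at x within S)"
    and "\<And>x. x \<in> S \<Longrightarrow> 0 \<le> g' x"
    and "inj_on g S"
  shows "set_integrable lebesgue S (\<lambda>x. F (g x) * g' x) \<longleftrightarrow> set_integrable lebesgue (g ` S) F"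
    and "(LINT x:S|lebesgue. F (g x) * g' x) = (LINT y:g ` S|lebesgue. F y)"
proof -
  have cong: "set_integrable lebesgue S (\<lambda>x. \<bar>g' x\<bar> * F (g x))
      \<longleftrightarrow> set_integrable lebesgue S (\<lambda>x. F (g x) * g' x)"
    using assms(3) by (intro set_integrable_cong) (auto simp: mult.commute)
  have int: "integral S (\<lambda>x. \<bar>g' x\<bar> * F (g x)) = integral S (\<lambda>x. F (g x) * g' x)"
    using assms(3) by (intro integral_cong) (auto simp: mult.commute)
  \<comment> \<open>The value \<open>r\<close> is left free: taking it to be the integral of either
    side separates the equivalence of integrability from the equality of the values.\<close>
  have cov: "set_integrable lebesgue S (\<lambda>x. F (g x) * g' x)
        \<and> integral S (\<lambda>x. F (g x) * g' x) = r
      \<longleftrightarrow> set_integrable lebesgue (g ` S) F \<and> integral (g ` S) F = r" for r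
    using has_absolute_integral_change_of_variables_1'[OF assms(1,2,4), of F r]
    by (simp add: cong int)
  show iff: "set_integrable lebesgue S (\<lambda>x. F (g x) * g' x) \<longleftrightarrow> set_integrable lebesgue (g ` S) F"
    using cov by blast
  show "(LINT x:S|lebesgue. F (g x) * g' x) = (LINT y:g ` S|lebesgue. F y)"
  proof (cases "set_integrable lebesgue (g ` S) F")
    case True
    then show ?thesis
      using iff cov by (metis set_lebesgue_integral_eq_integral(2))
  next
    \<comment> \<open>Neither side is integrable, so both Lebesgue integrals have the default value
      0.\<close>
    case False
    then show ?thesis
      using iff
      by (simp add: set_integrable_def set_lebesgue_integral_def not_integrable_integral_eq)
  qed
qed

text \<open>The theorem allows the regularity assumption to be put on f or on its transform, so the
  chain rule is needed in both directions: f composed with the inverse of g, whose derivative is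
  \<open>inverse d\<close>, or the transform composed with g.\<close>

lemma deriv_inv_subst_op:
  fixes f g :: "real \<Rightarrow> real"
  assumes cont: "continuous_on {a..b} g" and inj: "inj_on g {a..b}" and u: "u \<in> {a<..<b}"
    and g: "(g has_real_derivative d) (at u)" and d: "d \<noteq> 0"
    and diff: "f differentiable (at u) \<or> inv_subst_op a b g f differentiable (at (g u))"
  shows "deriv (inv_subst_op a b g f) (g u) * d = deriv f u"
proof -
  let ?h = "inv_subst_op a b g f"
  have inv: "inv_into {a..b} g (g y) = y" if "y \<in> {a<..<b}" for y
    using inj that by (intro inv_into_f_f) auto
  from diff show ?thesis
  proof
    assume "f differentiable (at u)"
    then have f: "(f has_real_derivative deriv f u) (at u)"
      by (simp add: DERIV_deriv_iff_real_differentiable)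
    have "(inv_into {a..b} g has_real_derivative inverse d) (at (g u))"
      unfolding has_field_derivative_def
    proof (rule has_derivative_inverse_strong[where S = "{a<..<b}" and f = g and x = u])
      show "continuous_on {a<..<b} g"
        using cont by (rule continuous_on_subset) auto
      show "(g has_derivative (*) d) (at u)"
        using g by (simp add: has_field_derivative_def)
      show "(*) d \<circ> (*) (inverse d) = id"
        using d by auto
    qed (use u inv in auto)
    from DERIV_chain2[OF _ this, of f "deriv f u"] f u
    have "(?h has_real_derivative deriv f u * inverse d) (at (g u))"
      by (simp add: inv inv_subst_op_def)
    then show ?thesis
      using d by (simp add: DERIV_imp_deriv)
  next
    assume "?h differentiable (at (g u))"
    then have "(?h has_real_derivative deriv ?h (g u)) (at (g u))"
      by (simp add: DERIV_deriv_iff_real_differentiable)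
    \<comment> \<open>The composite of the transform with g agrees with f on the open interval
      around u, hence has the same derivative there.\<close>
    from DERIV_chain2[OF this g]
    have "(f has_real_derivative deriv ?h (g u) * d) (at u)"
      by (rule has_field_derivative_transform_within_open[where S = "{a<..<b}"])
        (use u inv in \<open>auto simp: inv_subst_op_def\<close>)
    then show ?thesis
      by (simp add: DERIV_imp_deriv)
  qed
qed

text \<open>The classes only give derivatives within a half-open interval; at an interior point
  these are ordinary two-sided derivatives.\<close>

lemma differentiable_at_if_C1_minus1:
  assumes "f \<in> C1_minus1_left g a b \<or> f \<in> C1_minus1_right g a b" and u: "u \<in> {a<..<b}"
  shows "f differentiable (at u)"
  using assms(1)
proof
  assume "f \<in> C1_minus1_left g a b"
  then obtain d where "(f has_real_derivative d) (at u within {a<..b})"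
    using u by (force simp: C1_minus1_left_def)
  then show ?thesis
    using u at_within_interior[of u "{a<..b}"] by (auto simp: real_differentiable_def)
next
  assume "f \<in> C1_minus1_right g a b"
  then obtain d where "(f has_real_derivative d) (at u within {a..<b})"
    using u by (force simp: C1_minus1_right_def)
  then show ?thesis
    using u at_within_interior[of u "{a..<b}"] by (auto simp: real_differentiable_def)
qed

theorem proposition6:
  fixes M K g f :: "real \<Rightarrow> real" and a b :: real
  assumes "a < b"
    and "(M, K) \<in> luchko_L1 (b - a)"
    and "mono_on {a..<b} g"
    and "\<forall>x\<in>{a..<b}. 0 < g x"
    and "continuous_on {a..b} g"
    and "g differentiable_on {a<..<b}"
    and "continuous_on {a<..<b} (deriv g)"
    and "\<forall>x\<in>{a<..<b}. deriv g x \<noteq> 0"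
  shows
    "(f \<in> C1_minus1_left g a b \<or>
        inv_subst_op a b g f \<in> C1_minus1_left (\<lambda>x. x) (g a) (g b) \<longrightarrow>
      (\<forall>x\<in>{a<..b}.
        (gfd_caputo_left_defined K g a f x \<longleftrightarrow>
          gfd_caputo_left_defined K (\<lambda>x. x) (g a) (inv_subst_op a b g f) (g x)) \<and>
        gfd_caputo_left K g a f x =
          subst_op g (gfd_caputo_left K (\<lambda>x. x) (g a) (inv_subst_op a b g f)) x)) \<and>
     (f \<in> C1_minus1_right g a b \<or>
        inv_subst_op a b g f \<in> C1_minus1_right (\<lambda>x. x) (g a) (g b) \<longrightarrow>
      (\<forall>x\<in>{a..<b}.
        (gfd_caputo_right_defined K g b f x \<longleftrightarrow>
          gfd_caputo_right_defined K (\<lambda>x. x) (g b) (inv_subst_op a b g f) (g x)) \<and>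
        gfd_caputo_right K g b f x =
          subst_op g (gfd_caputo_right K (\<lambda>x. x) (g b) (inv_subst_op a b g f)) x))"
proof -
  let ?h = "inv_subst_op a b g f"
  have g_deriv: "(g has_real_derivative deriv g u) (at u)" if "u \<in> {a<..<b}" for u
    using assms(6) that
    by (simp add: DERIV_deriv_iff_real_differentiable differentiable_on_eq_differentiable_at)
  have g_pos: "0 < deriv g u" if "u \<in> {a<..<b}" for u
  proof -
    have "0 \<le> deriv g u"
      using mono_on_imp_deriv_nonneg[OF assms(3) g_deriv[OF that]] that by simp
    then show ?thesis
      using assms(8) that by force
  qed
  \<comment> \<open>Continuity on the closed interval carries strict monotonicity up to both
    endpoints, including b, where monotonicity is not assumed.\<close>
  have less: "g c < g d" if "a \<le> c" "c < d" "d \<le> b" for c d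
    using that g_deriv g_pos
    by (intro DERIV_pos_imp_increasing_open[OF that(2)] continuous_on_subset[OF assms(5)])
      (force, auto)
  have inj: "inj_on g {a..b}"
    by (rule inj_onI) (metis less atLeastAtMost_iff less_irrefl linorder_neqE_linordered_idom)
  have image: "g ` {c<..<d} = {g c<..<g d}" if cd: "a \<le> c" "c < d" "d \<le> b" for c d
  proof
    show "g ` {c<..<d} \<subseteq> {g c<..<g d}"
      using less cd by auto
    show "{g c<..<g d} \<subseteq> g ` {c<..<d}"
    proof
      fix y assume y: "y \<in> {g c<..<g d}"
      moreover have "continuous_on {c..d} g"
        using assms(5) cd by (auto intro: continuous_on_subset)
      ultimately obtain u where "c \<le> u" "u \<le> d" "g u = y"
        using IVT'[of g c y d] cd by auto
      with y show "y \<in> g ` {c<..<d}"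
        by (intro image_eqI[of _ _ u]) (auto simp: less_le)
    qed
  qed
  \<comment> \<open>The kernel \<open>k\<close> is an arbitrary function of \<open>g u\<close> and
    the interval is arbitrary, so that one substitution serves the left-sided and the right-sided
    operator.\<close>
  have change:
    "set_integrable lebesgue {c<..<d} (\<lambda>u. k (g u) * deriv f u)
      \<longleftrightarrow> set_integrable lebesgue {g c<..<g d} (\<lambda>w. k w * deriv ?h w)" (is ?integrable)
    "(LINT u:{c<..<d}|lebesgue. k (g u) * deriv f u)
      = (LINT w:{g c<..<g d}|lebesgue. k w * deriv ?h w)" (is ?integral)
    if cd: "a \<le> c" "c < d" "d \<le> b"
      and C1: "f \<in> C1_minus1_left g a b \<or> ?h \<in> C1_minus1_left (\<lambda>x. x) (g a) (g b) \<or>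
        f \<in> C1_minus1_right g a b \<or> ?h \<in> C1_minus1_right (\<lambda>x. x) (g a) (g b)"
    for c d and k :: "real \<Rightarrow> real"
  proof -
    have sub: "u \<in> {a<..<b}" if "u \<in> {c<..<d}" for u
      using cd that by auto
    \<comment> \<open>If the assumption is on the transform, it applies at \<open>g u\<close>, which
      lies strictly between \<open>g a\<close> and \<open>g b\<close>.\<close>
    have diff: "f differentiable (at u) \<or> ?h differentiable (at (g u))" if "u \<in> {a<..<b}" for u
      using C1 that less differentiable_at_if_C1_minus1[of f g a b u]
        differentiable_at_if_C1_minus1[of ?h "\<lambda>x. x" "g a" "g b" "g u"] by auto
    have eq: "k (g u) * deriv f u = k (g u) * deriv ?h (g u) * deriv g u" if "u \<in> {c<..<d}" for u
      using deriv_inv_subst_op[OF assms(5) inj sub[OF that] g_deriv[OF sub[OF that]]]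
        g_pos[OF sub[OF that]] diff[OF sub[OF that]] by simp
    have inj': "inj_on g {c<..<d}"
      using inj cd by (auto intro: inj_on_subset)
    have S: "{c<..<d} \<in> sets lebesgue"
      by simp
    note cov = set_integral_change_of_variables_incr[OF S _ _ inj', of "deriv g" "\<lambda>w. k w * deriv ?h w",
        OF has_field_derivative_at_within[OF g_deriv[OF sub]] less_imp_le[OF g_pos[OF sub]],
        unfolded image[OF cd]]
    show ?integrable
      using cov(1) by (subst set_integrable_cong[OF refl refl eq]) auto
    show ?integral
      using cov(2) by (subst set_lebesgue_integral_cong[OF S]) (use eq in auto)
  qed
  show ?thesis
    \<comment> \<open>With x fixed, the left-sided kernel is K(g x - w) on \<open>{a<..<x}\<close>
      and the right-sided one is K(w - g x) on \<open>{x<..<b}\<close>.\<close>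
    unfolding gfd_caputo_left_def gfd_caputo_left_defined_def
      gfd_caputo_right_def gfd_caputo_right_defined_def subst_op_def
  proof (intro conjI impI ballI, goal_cases)
    case (1 x)
    then show ?case
      using change(1)[of a x "\<lambda>w. K (g x - w)"] by auto
  next
    case (2 x)
    then show ?case
      using change(2)[of a x "\<lambda>w. K (g x - w)"] by auto
  next
    case (3 x)
    then show ?case
      using change(1)[of x b "\<lambda>w. K (w - g x)"] by auto
  next
    case (4 x)
    then show ?case
      using change(2)[of x b "\<lambda>w. K (w - g x)"] by auto
  qed
qed

end
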